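(* Let $\mathfrak{H}$ be a separable Hilbert space and let $T(\lambda)=T_0+\lambda T_1$, $\lambda\in\mathbb{T}$, be a contractive linear pencil of operators on $\mathfrak{H}$. Let $\mathfrak{Y}$ be a separable Hilbert space and $F(z)=F_0+zF_1$ a linear outer function, with $F_0,F_1$ bounded linear operators from $\mathfrak{H}$ to $\mathfrak{Y}$, such that $$F(\lambda)^*F(\lambda)=I_{\mathfrak{H}}-T(\lambda)^*T(\lambda)\qquad(\lambda\in\mathbb{T}).$$ Set $\mathfrak{K}_+:=\left(\bigoplus_{-\infty}^{-1}\mathfrak{Y}\right)\oplus\mathfrak{H}$, and for $\lambda\in\mathbb{T}$ define $V(\lambda):\mathfrak{K}_+\to\mathfrak{K}_+$ by $$V(\lambda)\,(\ldots,y_{-3},y_{-2},y_{-1},h):=(\ldots,y_{-2},y_{-1},F(\lambda)h,\,T(\lambda)h),$$ where on the right-hand side $T(\lambda)h$ is the $\mathfrak{H}$-component, $F(\lambda)h$ is the component in the $(-1)$-st copy of $\mathfrak{Y}$, and $y_{-k}$ is the component in the $(-k-1)$-st copy of $\mathfrak{Y}$ for $k\ge1$. Then $V(\lambda)$, $\lambda\in\mathbb{T}$, is a minimal isometric dilation of $T(\lambda)$. Moreover, $V(\lambda)$ is a minimal uniform isometric dilation of $T(\lambda)$.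
   Context: Hilbert spaces are complex; subspaces are closed; $\mathbb{T}=\{\lambda\in\mathbb{C}:|\lambda|=1\}$; $\mathbb{D}$ is the open unit disk; $\mathbb{Z}_+=\{0,1,2,\dots\}$; $P_{\mathfrak{H}}$ is the orthogonal projector onto $\mathfrak{H}$; $A|\mathfrak{H}$ is the restriction of $A$ to $\mathfrak{H}$. A vector $h\in\mathfrak{H}$ is identified with $(\ldots,0,0,h)\in\mathfrak{K}_+$. A linear pencil on $\mathfrak{H}$ is a family $T(\lambda)=T_0+\lambda T_1$, $\lambda\in\mathbb{T}$, with $T_0,T_1$ bounded linear operators on $\mathfrak{H}$. It is called contractive (resp. isometric) if $T(\lambda)$ is a contraction (resp. an isometry) for every $\lambda\in\mathbb{T}$. For a separable Hilbert space $\mathfrak{X}$, $H^2_{\mathfrak{X}}(\mathbb{D})$ is the Hardy space of holomorphic $\mathfrak{X}$-valued functions $x$ on $\mathbb{D}$ with $\|x\|^2=(2\pi)^{-1}\sup_{0<r<1}\int_0^{2\pi}\|x(re^{is})\|^2\,ds<\infty$. A contractive holomorphic function $\theta$ on $\mathbb{D}$, whose values are bounded operators from $\mathfrak{X}$ to $\mathfrak{X}_*$ (separable Hilbert spaces), is outer if $\theta H^2_{\mathfrak{X}}(\mathbb{D})$ is dense in $H^2_{\mathfrak{X}_*}(\mathbb{D})$. By the operator Fejér–Riesz theorem, a space $\mathfrak{Y}$ and a linear outer function $F$ with the required factorization property exist for every contractive linear pencil $T(\lambda)$, and $F$ is unique up to a unitary operator factor from the left. A linear pencil $\widetilde{T}(\lambda)$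 on a Hilbert space $\widetilde{\mathfrak{H}}$ is a dilation of a linear pencil $T(\lambda)$ on $\mathfrak{H}$ if $\widetilde{\mathfrak{H}}\supset\mathfrak{H}$ and $T(\lambda)^n=P_{\mathfrak{H}}\widetilde{T}(\lambda)^n|\mathfrak{H}$ for all $\lambda\in\mathbb{T}$ and $n\in\mathbb{Z}_+$. The dilation is uniform if $T(\lambda_1)\cdots T(\lambda_n)=P_{\mathfrak{H}}\widetilde{T}(\lambda_1)\cdots\widetilde{T}(\lambda_n)|\mathfrak{H}$ for all $n\in\mathbb{N}$ and all $\lambda_1,\dots,\lambda_n\in\mathbb{T}$. An isometric dilation of a contractive linear pencil is a dilation that is an isometric linear pencil. An isometric dilation (resp. uniform isometric dilation) $\widetilde{T}(\lambda)$ of $T(\lambda)$ on $\widetilde{\mathfrak{H}}$ is minimal if it is minimal in the natural partial order on the set of all isometric dilations (resp. all uniform isometric dilations) of $T(\lambda)$; that is, whenever $\mathfrak{H}'$ is a subspace with $\mathfrak{H}\subset\mathfrak{H}'\subset\widetilde{\mathfrak{H}}$ such that the compressed pencil $T'(\lambda)=P_{\mathfrak{H}'}\widetilde{T}(\lambda)|\mathfrak{H}'$ is an isometric dilation (resp. uniform isometric dilation) of $T(\lambda)$, then $\mathfrak{H}'=\widetilde{\mathfrak{H}}$. *)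

theory Defs
  imports "HOL-Analysis.Analysis"
begin

section \<open>Complex Hilbert spaces\<close>

text \<open>
  The norm, metric and real inner product are inherited from \<^class>\<open>real_inner\<close>. The complex
  inner product is linear in its first argument, and \<open>inner_eq_Re_cinner\<close> makes the norm the one
  it induces.
\<close>

class complex_inner = real_inner +
  fixes scaleC :: "complex \<Rightarrow> 'a \<Rightarrow> 'a" (infixr "*\<^sub>C" 75)
    and cinner :: "'a \<Rightarrow> 'a \<Rightarrow> complex"
  assumes scaleC_add_right: "a *\<^sub>C (x + y) = a *\<^sub>C x + a *\<^sub>C y"
    and scaleC_add_left: "(a + b) *\<^sub>C x = a *\<^sub>C x + b *\<^sub>C x"
    and scaleC_scaleC: "a *\<^sub>C (b *\<^sub>C x) = (a * b) *\<^sub>C x"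
    and scaleC_of_real: "complex_of_real r *\<^sub>C x = r *\<^sub>R x"
    and cinner_commute: "cinner x y = cnj (cinner y x)"
    and cinner_add_left: "cinner (x + y) z = cinner x z + cinner y z"
    and cinner_scaleC_left: "cinner (a *\<^sub>C x) y = a * cinner x y"
    and inner_eq_Re_cinner: "inner x y = Re (cinner x y)"

class chilbert_space = complex_inner + complete_space

lemma cinner_add_right: "cinner x (y + z) = cinner x y + cinner x (z::'a::complex_inner)"
  by (metis cinner_add_left cinner_commute complex_cnj_add)

lemma cinner_scaleC_right: "cinner x (a *\<^sub>C y) = cnj a * cinner x (y::'a::complex_inner)"
  by (metis cinner_commute cinner_scaleC_left complex_cnj_mult)

lemma cinner_self: "cinner x x = complex_of_real ((norm x)\<^sup>2)" for x :: "'a::complex_inner"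
proof -
  have "Im (cinner x x) = 0"
    using cinner_commute[of x x] by (metis Im_divide_of_real cnj.simps(2) equal_neg_zero)
  then show ?thesis
    by (simp add: complex_eq_iff power2_norm_eq_inner inner_eq_Re_cinner)
qed

lemma norm_scaleC: "norm (a *\<^sub>C x) = cmod a * norm x" for x :: "'a::complex_inner"
proof -
  have "complex_of_real ((norm (a *\<^sub>C x))\<^sup>2) = a * cnj a * complex_of_real ((norm x)\<^sup>2)"
    by (simp only: cinner_self[symmetric] cinner_scaleC_left cinner_scaleC_right ac_simps)
  also have "\<dots> = complex_of_real ((cmod a * norm x)\<^sup>2)"
    by (simp add: power_mult_distrib complex_norm_square[symmetric])
  finally have "(norm (a *\<^sub>C x))\<^sup>2 = (cmod a * norm x)\<^sup>2"
    using of_real_eq_iff by blast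
  then show ?thesis by (simp add: power2_eq_iff_nonneg)
qed

lemma scaleC_zero_right: "a *\<^sub>C (0::'a::complex_inner) = 0"
  by (metis add_cancel_right_right scaleC_add_right)

lemma cmod_cinner_le: "cmod (cinner x y) \<le> norm x * norm y" for x y :: "'a::complex_inner"
proof (cases "cinner x y = 0")
  case False
  let ?c = "cnj (cinner x y) / cmod (cinner x y)"
  have c: "cmod ?c = 1" using False by (simp add: norm_divide)
  have "cinner (?c *\<^sub>C x) y = complex_of_real (cmod (cinner x y))"
    using False by (simp add: cinner_scaleC_left complex_norm_square[symmetric] power2_eq_square
        mult.commute)
  then have "cmod (cinner x y) = inner (?c *\<^sub>C x) y"
    by (simp add: inner_eq_Re_cinner)
  also have "\<dots> \<le> norm (?c *\<^sub>C x) * norm y" by (rule norm_cauchy_schwarz)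
  also have "\<dots> = norm x * norm y" by (simp only: norm_scaleC c mult_1)
  finally show ?thesis .
qed simp

instantiation complex :: chilbert_space
begin

definition "a *\<^sub>C x = a * x" for a x :: complex
definition "cinner x y = x * cnj y" for x y :: complex

instance
  by standard (simp_all add: scaleC_complex_def cinner_complex_def inner_complex_def
      scaleR_conv_of_real algebra_simps)

end

instantiation prod :: (complex_inner, complex_inner) complex_inner
begin

definition "a *\<^sub>C x = (a *\<^sub>C fst x, a *\<^sub>C snd x)"
definition "cinner x y = cinner (fst x) (fst y) + cinner (snd x) (snd y)"

instance
proof
  fix x y :: "'a \<times> 'b"
  show "cinner x y = cnj (cinner y x)"
    by (simp add: cinner_prod_def cinner_commute[of "fst x"] cinner_commute[of "snd x"])
qed (simp_all add: scaleC_prod_def cinner_prod_def scaleC_add_right scaleC_add_left scaleC_scaleC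
    scaleC_of_real cinner_add_left cinner_scaleC_left inner_eq_Re_cinner inner_prod_def
    prod_eq_iff algebra_simps)

end

instance prod :: (chilbert_space, chilbert_space) chilbert_space ..

section \<open>The Hilbert space of square summable sequences\<close>

typedef (overloaded) 'a ell2 = "{f :: nat \<Rightarrow> 'a::complex_inner. summable (\<lambda>n. (norm (f n))\<^sup>2)}"
  by (rule exI[of _ "\<lambda>_. 0"]) simp

setup_lifting type_definition_ell2

lemma ell2_summable_add:
  fixes f g :: "nat \<Rightarrow> 'a::complex_inner"
  assumes "summable (\<lambda>n. (norm (f n))\<^sup>2)" "summable (\<lambda>n. (norm (g n))\<^sup>2)"
  shows "summable (\<lambda>n. (norm (f n + g n))\<^sup>2)"
proof (rule summable_comparison_test')
  show "summable (\<lambda>n. 2 * (norm (f n))\<^sup>2 + 2 * (norm (g n))\<^sup>2)"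
    by (intro summable_add summable_mult assms)
  fix n :: nat
  have "(norm (f n + g n))\<^sup>2 \<le> (norm (f n) + norm (g n))\<^sup>2"
    by (simp add: norm_triangle_ineq power_mono)
  also have "\<dots> \<le> 2 * (norm (f n))\<^sup>2 + 2 * (norm (g n))\<^sup>2"
    using sum_squares_bound[of "norm (f n)" "norm (g n)"] by (simp add: power2_sum)
  finally show "norm ((norm (f n + g n))\<^sup>2) \<le> 2 * (norm (f n))\<^sup>2 + 2 * (norm (g n))\<^sup>2" by simp
qed

lemma ell2_summable_scaleC:
  fixes f :: "nat \<Rightarrow> 'a::complex_inner"
  assumes "summable (\<lambda>n. (norm (f n))\<^sup>2)"
  shows "summable (\<lambda>n. (norm (a *\<^sub>C f n))\<^sup>2)"
  using summable_mult[OF assms, of "(cmod a)\<^sup>2"] by (simp add: norm_scaleC power_mult_distrib)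

lemma ell2_summable_cinner:
  fixes f g :: "nat \<Rightarrow> 'a::complex_inner"
  assumes "summable (\<lambda>n. (norm (f n))\<^sup>2)" "summable (\<lambda>n. (norm (g n))\<^sup>2)"
  shows "summable (\<lambda>n. cinner (f n) (g n))"
proof (rule summable_comparison_test')
  show "summable (\<lambda>n. (norm (f n))\<^sup>2 + (norm (g n))\<^sup>2)"
    by (intro summable_add assms)
  fix n :: nat
  have "cmod (cinner (f n) (g n)) \<le> norm (f n) * norm (g n)" by (rule cmod_cinner_le)
  also have "\<dots> \<le> (norm (f n))\<^sup>2 + (norm (g n))\<^sup>2"
    using sum_squares_bound[of "norm (f n)" "norm (g n)"]
      mult_nonneg_nonneg[OF norm_ge_zero[of "f n"] norm_ge_zero[of "g n"]] by linarith
  finally show "norm (cinner (f n) (g n)) \<le> (norm (f n))\<^sup>2 + (norm (g n))\<^sup>2" .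
qed

instantiation ell2 :: (complex_inner) complex_inner
begin

lift_definition zero_ell2 :: "'a ell2" is "\<lambda>_. 0" by simp
lift_definition plus_ell2 :: "'a ell2 \<Rightarrow> 'a ell2 \<Rightarrow> 'a ell2" is "\<lambda>f g n. f n + g n"
  by (rule ell2_summable_add)
lift_definition uminus_ell2 :: "'a ell2 \<Rightarrow> 'a ell2" is "\<lambda>f n. - f n" by simp
lift_definition minus_ell2 :: "'a ell2 \<Rightarrow> 'a ell2 \<Rightarrow> 'a ell2" is "\<lambda>f g n. f n - g n"
  using ell2_summable_add[where g = "\<lambda>n. - _ n"] by fastforce
lift_definition scaleC_ell2 :: "complex \<Rightarrow> 'a ell2 \<Rightarrow> 'a ell2" is "\<lambda>a f n. a *\<^sub>C f n"
  by (rule ell2_summable_scaleC)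
lift_definition cinner_ell2 :: "'a ell2 \<Rightarrow> 'a ell2 \<Rightarrow> complex"
  is "\<lambda>f g. \<Sum>n. cinner (f n) (g n)" .

definition "r *\<^sub>R x = complex_of_real r *\<^sub>C x" for x :: "'a ell2"
definition "inner x y = Re (cinner x y)" for x y :: "'a ell2"
definition "norm x = sqrt (inner x x)" for x :: "'a ell2"
definition "sgn x = inverse (norm x) *\<^sub>R x" for x :: "'a ell2"
definition "dist x y = norm (x - y)" for x y :: "'a ell2"
definition [code del]:
  "(uniformity :: ('a ell2 \<times> 'a ell2) filter) =
     (INF e\<in>{0 <..}. principal {(x, y). dist x y < (e::real)})"
definition [code del]:
  "open U \<longleftrightarrow> (\<forall>x\<in>U. eventually (\<lambda>(x', y). x' = x \<longrightarrow> y \<in> U) uniformity)" for U :: "'a ell2 set"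

instance
proof
  fix x y z :: "'a ell2" and a b :: complex and r s :: real
  show 1: "a *\<^sub>C (x + y) = a *\<^sub>C x + a *\<^sub>C y" for a and x y :: "'a ell2"
    by transfer (simp add: scaleC_add_right)
  show 2: "(a + b) *\<^sub>C x = a *\<^sub>C x + b *\<^sub>C x" for a b and x :: "'a ell2"
    by transfer (simp add: scaleC_add_left)
  show 3: "a *\<^sub>C (b *\<^sub>C x) = (a * b) *\<^sub>C x" for a b and x :: "'a ell2"
    by transfer (simp add: scaleC_scaleC)
  show "complex_of_real r *\<^sub>C x = r *\<^sub>R x" by (simp add: scaleR_ell2_def)
  show comm: "cinner x y = cnj (cinner y x)" for x y :: "'a ell2"
  proof transfer
    fix f g :: "nat \<Rightarrow> 'a"
    assume *: "summable (\<lambda>n. (norm (f n))\<^sup>2)" "summable (\<lambda>n. (norm (g n))\<^sup>2)"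
    have "(\<lambda>n. cinner (g n) (f n)) sums (\<Sum>n. cinner (g n) (f n))"
      by (rule summable_sums[OF ell2_summable_cinner[OF *(2) *(1)]])
    then have "(\<lambda>n. cinner (f n) (g n)) sums cnj (\<Sum>n. cinner (g n) (f n))"
      by (subst cinner_commute) (simp add: sums_cnj)
    then show "(\<Sum>n. cinner (f n) (g n)) = cnj (\<Sum>n. cinner (g n) (f n))"
      by (simp add: sums_iff)
  qed
  show add: "cinner (x + y) z = cinner x z + cinner y z"  for x y z :: "'a ell2"
    by transfer (simp add: cinner_add_left suminf_add ell2_summable_cinner)
  show scl: "cinner (a *\<^sub>C x) y = a * cinner x y" for a and x y :: "'a ell2"
    by transfer (simp add: cinner_scaleC_left suminf_mult ell2_summable_cinner)
  show "inner x y = Re (cinner x y)" by (simp add: inner_ell2_def)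
  show "x + y + z = x + (y + z)" by transfer (simp add: add.assoc)
  show "x + y = y + x" by transfer (simp add: add.commute)
  show "0 + x = x" by transfer simp
  show "- x + x = 0" by transfer simp
  show "x - y = x + - y" by transfer simp
  show "r *\<^sub>R (x + y) = r *\<^sub>R x + r *\<^sub>R y" by (simp add: scaleR_ell2_def 1)
  show "(r + s) *\<^sub>R x = r *\<^sub>R x + s *\<^sub>R x" by (simp add: scaleR_ell2_def 2)
  show "r *\<^sub>R s *\<^sub>R x = (r * s) *\<^sub>R x" by (simp add: scaleR_ell2_def 3)
  show "1 *\<^sub>R x = x"
    unfolding scaleR_ell2_def by transfer (simp only: scaleC_of_real scaleR_one)
  show "sgn x = inverse (norm x) *\<^sub>R x" by (simp add: sgn_ell2_def)
  show "dist x y = norm (x - y)" by (simp add: dist_ell2_def)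
  show "uniformity = (INF e\<in>{0 <..}. principal {(x :: 'a ell2, y). dist x y < e})"
    by (rule uniformity_ell2_def)
  show "open U \<longleftrightarrow> (\<forall>x\<in>U. eventually (\<lambda>(x', y). x' = x \<longrightarrow> y \<in> U) uniformity)"
    for U :: "'a ell2 set" by (rule open_ell2_def)
  show "inner x y = inner y x"
    unfolding inner_ell2_def by (subst comm) simp
  show "inner (x + y) z = inner x z + inner y z" by (simp add: inner_ell2_def add)
  show "inner (r *\<^sub>R x) y = r * inner x y"
    by (simp add: inner_ell2_def scaleR_ell2_def scl)
  have self: "inner x x = (\<Sum>n. (norm (Rep_ell2 x n))\<^sup>2)"
  proof -
    have "cinner x x = (\<Sum>n. complex_of_real ((norm (Rep_ell2 x n))\<^sup>2))"
      by transfer (simp add: cinner_self)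
    also have "\<dots> = complex_of_real (\<Sum>n. (norm (Rep_ell2 x n))\<^sup>2)"
      using Rep_ell2[of x] by (simp add: suminf_of_real)
    finally show ?thesis by (simp add: inner_ell2_def)
  qed
  have sm: "summable (\<lambda>n. (norm (Rep_ell2 x n))\<^sup>2)" using Rep_ell2[of x] by simp
  show "0 \<le> inner x x" unfolding self by (rule suminf_nonneg[OF sm]) simp
  have "inner x x = 0 \<longleftrightarrow> (\<forall>n. Rep_ell2 x n = 0)"
    unfolding self using suminf_eq_zero_iff[OF sm] by simp
  also have "\<dots> \<longleftrightarrow> x = 0" by transfer auto
  finally show "inner x x = 0 \<longleftrightarrow> x = 0" .
  show "norm x = sqrt (inner x x)" by (rule norm_ell2_def)
qed

end

lemma norm_ell2_sums: "(\<lambda>n. (norm (Rep_ell2 x n))\<^sup>2) sums (norm x)\<^sup>2"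
  for x :: "'a::complex_inner ell2"
proof -
  have sm: "summable (\<lambda>n. (norm (Rep_ell2 x n))\<^sup>2)" using Rep_ell2[of x] by simp
  have "complex_of_real ((norm x)\<^sup>2) = (\<Sum>n. complex_of_real ((norm (Rep_ell2 x n))\<^sup>2))"
    unfolding cinner_self[symmetric] by transfer simp
  also have "\<dots> = complex_of_real (\<Sum>n. (norm (Rep_ell2 x n))\<^sup>2)"
    by (rule suminf_of_real[OF sm, symmetric])
  finally have "(norm x)\<^sup>2 = (\<Sum>n. (norm (Rep_ell2 x n))\<^sup>2)" using of_real_eq_iff by blast
  then show ?thesis using summable_sums[OF sm] by simp
qed

instance ell2 :: (chilbert_space) chilbert_space
proof
  fix X :: "nat \<Rightarrow> 'a ell2"
  assume X: "Cauchy X"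
  define f where "f k n = Rep_ell2 (X k) n" for k n
  have diff: "Rep_ell2 (x - y) n = Rep_ell2 x n - Rep_ell2 y n" for x y :: "'a ell2" and n
    by (simp add: minus_ell2.rep_eq)
  have part: "(\<Sum>n<N. (norm (Rep_ell2 x n))\<^sup>2) \<le> (norm x)\<^sup>2" for x :: "'a ell2" and N
    using norm_ell2_sums[of x] by (metis sum_le_suminf finite_lessThan sums_iff zero_le_power2)
  have comp: "norm (Rep_ell2 x n) \<le> norm x" for x :: "'a ell2" and n
  proof -
    have "(norm (Rep_ell2 x n))\<^sup>2 \<le> (\<Sum>n<Suc n. (norm (Rep_ell2 x n))\<^sup>2)"
      by (rule member_le_sum) auto
    then have "(norm (Rep_ell2 x n))\<^sup>2 \<le> (norm x)\<^sup>2" using part order_trans by blast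
    then show ?thesis by (rule power2_le_imp_le) simp
  qed
  have "Cauchy (\<lambda>k. f k n)" for n
  proof (rule metric_CauchyI)
    fix e :: real assume "0 < e"
    then obtain M where "\<forall>m\<ge>M. \<forall>k\<ge>M. dist (X m) (X k) < e" using X metric_CauchyD by blast
    then show "\<exists>M. \<forall>m\<ge>M. \<forall>k\<ge>M. dist (f m n) (f k n) < e"
      by (metis comp diff dist_norm f_def order_le_less_trans)
  qed
  then have "\<exists>l. (\<lambda>k. f k n) \<longlonglongrightarrow> l" for n using Cauchy_convergent convergent_def by blast
  then obtain l where l: "(\<lambda>k. f k n) \<longlonglongrightarrow> l n" for n by metis
  have bd: "(\<Sum>n<N. (norm (f m n - l n))\<^sup>2) \<le> e\<^sup>2"
    if "\<forall>m\<ge>M. \<forall>k\<ge>M. dist (X m) (X k) < e" "m \<ge> M" for e M m N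
  proof (rule LIMSEQ_le_const2)
    show "(\<lambda>k. \<Sum>n<N. (norm (f m n - f k n))\<^sup>2) \<longlonglongrightarrow> (\<Sum>n<N. (norm (f m n - l n))\<^sup>2)"
      by (intro tendsto_intros l)
    have "(\<Sum>n<N. (norm (f m n - f k n))\<^sup>2) \<le> e\<^sup>2" if "k \<ge> M" for k
    proof -
      have "(\<Sum>n<N. (norm (f m n - f k n))\<^sup>2) \<le> (norm (X m - X k))\<^sup>2"
        using part[where x = "X m - X k"] by (simp add: diff f_def)
      also have "\<dots> \<le> e\<^sup>2"
        using \<open>\<forall>m\<ge>M. \<forall>k\<ge>M. dist (X m) (X k) < e\<close> \<open>m \<ge> M\<close> that
        by (intro power_mono) (auto simp: dist_norm less_imp_le)
      finally show ?thesis .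
    qed
    then show "\<exists>K. \<forall>k\<ge>K. (\<Sum>n<N. (norm (f m n - f k n))\<^sup>2) \<le> e\<^sup>2" by blast
  qed
  have sd: "summable (\<lambda>n. (norm (f m n - l n))\<^sup>2)"
    if "\<forall>m\<ge>M. \<forall>k\<ge>M. dist (X m) (X k) < e" "m \<ge> M" for e M m
    by (rule summableI_nonneg_bounded[OF _ bd[OF that]]) simp
  have "summable (\<lambda>n. (norm (l n))\<^sup>2)"
  proof -
    obtain M where M: "\<forall>m\<ge>M. \<forall>k\<ge>M. dist (X m) (X k) < 1" using X metric_CauchyD zero_less_one by blast
    have a: "summable (\<lambda>n. (norm (- (f M n - l n)))\<^sup>2)"
      using sd[OF M, of M] by (simp add: norm_minus_commute)
    have b: "summable (\<lambda>n. (norm (f M n))\<^sup>2)" using Rep_ell2[of "X M"] by (simp add: f_def)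
    show ?thesis using ell2_summable_add[OF a b] by simp
  qed
  then have L: "Rep_ell2 (Abs_ell2 l) = l" by (simp add: Abs_ell2_inverse)
  have "X \<longlonglongrightarrow> Abs_ell2 l"
  proof (rule metric_LIMSEQ_I)
    fix e :: real assume "0 < e"
    then obtain M where M: "\<forall>m\<ge>M. \<forall>k\<ge>M. dist (X m) (X k) < e / 2"
      using X metric_CauchyD half_gt_zero by blast
    have "dist (X m) (Abs_ell2 l) < e" if "m \<ge> M" for m
    proof -
      have "(\<lambda>n. (norm (f m n - l n))\<^sup>2) sums (norm (X m - Abs_ell2 l))\<^sup>2"
        using norm_ell2_sums[of "X m - Abs_ell2 l"] by (simp add: diff L f_def)
      then have "(norm (X m - Abs_ell2 l))\<^sup>2 \<le> (e / 2)\<^sup>2"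
        using bd[OF M that] by (metis sums_iff suminf_le_const)
      then have "norm (X m - Abs_ell2 l) \<le> e / 2"
        by (rule power2_le_imp_le) (use \<open>0 < e\<close> in simp)
      then show ?thesis using \<open>0 < e\<close> by (simp add: dist_norm)
    qed
    then show "\<exists>no. \<forall>m\<ge>no. dist (X m) (Abs_ell2 l) < e" by blast
  qed
  then show "convergent X" by (auto simp: convergent_def)
qed

section \<open>Operators, adjoints and projectors\<close>

text \<open>
  A Hilbert space may be a closed subspace of a type; an operator is then a function on the whole
  type of which only the values on the subspace matter.
\<close>

definition closed_csubspace :: "'a::complex_inner set \<Rightarrow> bool" where
  "closed_csubspace S \<longleftrightarrow>
     closed S \<and> 0 \<in> S \<and> (\<forall>x\<in>S. \<forall>y\<in>S. x + y \<in> S) \<and> (\<forall>a. \<forall>x\<in>S. a *\<^sub>C x \<in> S)"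

definition bounded_op_on ::
  "'a::complex_inner set \<Rightarrow> 'b::complex_inner set \<Rightarrow> ('a \<Rightarrow> 'b) \<Rightarrow> bool" where
  "bounded_op_on S R A \<longleftrightarrow>
     (\<forall>x\<in>S. A x \<in> R) \<and>
     (\<forall>x\<in>S. \<forall>y\<in>S. A (x + y) = A x + A y) \<and>
     (\<forall>a. \<forall>x\<in>S. A (a *\<^sub>C x) = a *\<^sub>C A x) \<and>
     (\<exists>K. \<forall>x\<in>S. norm (A x) \<le> K * norm x)"

abbreviation bounded_op :: "('a::complex_inner \<Rightarrow> 'b::complex_inner) \<Rightarrow> bool" where
  "bounded_op \<equiv> bounded_op_on UNIV UNIV"

text \<open>
  The descriptions below determine unique objects by the Riesz representation theorem if \<open>A\<close> is a
  bounded operator, and by the projection theorem if \<open>S\<close> is a closed subspace.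
\<close>

definition cadjoint :: "('a::chilbert_space \<Rightarrow> 'b::chilbert_space) \<Rightarrow> 'b \<Rightarrow> 'a" where
  "cadjoint A = (THE B. \<forall>x y. cinner (A x) y = cinner x (B y))"

definition proj :: "'a::chilbert_space set \<Rightarrow> 'a \<Rightarrow> 'a" where
  "proj S x = (THE y. y \<in> S \<and> (\<forall>z\<in>S. cinner (x - y) z = 0))"

section \<open>Hardy spaces and outer functions\<close>

definition unit_disk :: "complex set" where
  "unit_disk = ball 0 1"

definition holomorphic_vec :: "(complex \<Rightarrow> 'a::complex_inner) \<Rightarrow> bool" where
  "holomorphic_vec f \<longleftrightarrow>
     (\<forall>z\<in>unit_disk. \<exists>d. ((\<lambda>w. inverse (w - z) *\<^sub>C (f w - f z)) \<longlongrightarrow> d) (at z))"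

text \<open>Complex differentiability with respect to the operator norm.\<close>

definition holomorphic_op ::
  "(complex \<Rightarrow> 'a::complex_inner \<Rightarrow> 'b::complex_inner) \<Rightarrow> bool" where
  "holomorphic_op \<theta> \<longleftrightarrow>
     (\<forall>z\<in>unit_disk. bounded_op (\<theta> z)) \<and>
     (\<forall>z\<in>unit_disk. \<exists>D. bounded_op D \<and>
        ((\<lambda>w. onorm (\<lambda>x. inverse (w - z) *\<^sub>C (\<theta> w x - \<theta> z x) - D x)) \<longlongrightarrow> 0) (at z))"

definition circle_integral :: "(complex \<Rightarrow> 'a::complex_inner) \<Rightarrow> real \<Rightarrow> real" where
  "circle_integral f r = integral {0..2 * pi} (\<lambda>s. (norm (f (complex_of_real r * cis s)))\<^sup>2)"

text \<open>
  Elements of the Hardy space are represented by functions on the whole plane; their values outside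
  the disk are irrelevant, and neither \<open>hardy2\<close> nor \<open>hardy2_norm\<close> depends on them.
\<close>

definition hardy2 :: "(complex \<Rightarrow> 'a::complex_inner) set" where
  "hardy2 = {f. holomorphic_vec f \<and> bdd_above (circle_integral f ` {0<..<1})}"

definition hardy2_norm :: "(complex \<Rightarrow> 'a::complex_inner) \<Rightarrow> real" where
  "hardy2_norm f = sqrt (1 / (2 * pi) * (SUP r\<in>{0<..<1}. circle_integral f r))"

definition outer :: "(complex \<Rightarrow> 'a::complex_inner \<Rightarrow> 'b::complex_inner) \<Rightarrow> bool" where
  "outer \<theta> \<longleftrightarrow>
     holomorphic_op \<theta> \<and>
     (\<forall>z\<in>unit_disk. \<forall>x. norm (\<theta> z x) \<le> norm x) \<and>
     (\<forall>g\<in>hardy2. \<forall>\<epsilon>>0. \<exists>f\<in>hardy2. hardy2_norm (\<lambda>z. g z - \<theta> z (f z)) < \<epsilon>)"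

section \<open>Linear pencils and their dilations\<close>

definition unit_circle :: "complex set" where
  "unit_circle = sphere 0 1"

definition pencil ::
  "('a::complex_inner \<Rightarrow> 'b::complex_inner) \<Rightarrow> ('a \<Rightarrow> 'b) \<Rightarrow> complex \<Rightarrow> 'a \<Rightarrow> 'b" where
  "pencil A0 A1 \<zeta> x = A0 x + \<zeta> *\<^sub>C A1 x"

definition linear_pencil_on ::
  "'a::complex_inner set \<Rightarrow> (complex \<Rightarrow> 'a \<Rightarrow> 'a) \<Rightarrow> bool" where
  "linear_pencil_on S A \<longleftrightarrow>
     closed_csubspace S \<and>
     (\<exists>A0 A1. bounded_op_on S S A0 \<and> bounded_op_on S S A1 \<and>
        (\<forall>\<zeta>\<in>unit_circle. \<forall>x\<in>S. A \<zeta> x = pencil A0 A1 \<zeta> x))"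

definition contractive_pencil_on ::
  "'a::complex_inner set \<Rightarrow> (complex \<Rightarrow> 'a \<Rightarrow> 'a) \<Rightarrow> bool" where
  "contractive_pencil_on S A \<longleftrightarrow>
     linear_pencil_on S A \<and> (\<forall>\<zeta>\<in>unit_circle. \<forall>x\<in>S. norm (A \<zeta> x) \<le> norm x)"

definition isometric_pencil_on ::
  "'a::complex_inner set \<Rightarrow> (complex \<Rightarrow> 'a \<Rightarrow> 'a) \<Rightarrow> bool" where
  "isometric_pencil_on S A \<longleftrightarrow>
     linear_pencil_on S A \<and> (\<forall>\<zeta>\<in>unit_circle. \<forall>x\<in>S. norm (A \<zeta> x) = norm x)"

text \<open>
  The inclusion of \<open>'h\<close> into the larger space \<open>S\<close> is an isometric embedding \<open>J\<close>. Thus \<open>range J\<close> is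
  the copy of \<open>'h\<close> in \<open>S\<close>, and an identity \<open>B = P A\<close> on \<open>'h\<close>, with \<open>P\<close> the projector onto \<open>'h\<close>,
  becomes \<open>J (B h) = proj (range J) (A (J h))\<close>.
\<close>

definition isometric_embedding :: "('h::complex_inner \<Rightarrow> 'k::complex_inner) \<Rightarrow> bool" where
  "isometric_embedding J \<longleftrightarrow> bounded_op J \<and> (\<forall>h. norm (J h) = norm h)"

definition dilation ::
  "('h::chilbert_space \<Rightarrow> 'k::chilbert_space) \<Rightarrow> (complex \<Rightarrow> 'h \<Rightarrow> 'h) \<Rightarrow>
     'k set \<Rightarrow> (complex \<Rightarrow> 'k \<Rightarrow> 'k) \<Rightarrow> bool" where
  "dilation J T S A \<longleftrightarrow>
     linear_pencil_on UNIV T \<and> linear_pencil_on S A \<and>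
     isometric_embedding J \<and> range J \<subseteq> S \<and>
     (\<forall>\<zeta>\<in>unit_circle. \<forall>n h. J ((T \<zeta> ^^ n) h) = proj (range J) ((A \<zeta> ^^ n) (J h)))"

text \<open>
  \<open>foldr T [\<zeta>\<^sub>1, \<dots>, \<zeta>\<^sub>n] h\<close> is \<open>T \<zeta>\<^sub>1 (\<dots> (T \<zeta>\<^sub>n h))\<close>.
\<close>

definition uniform_dilation ::
  "('h::chilbert_space \<Rightarrow> 'k::chilbert_space) \<Rightarrow> (complex \<Rightarrow> 'h \<Rightarrow> 'h) \<Rightarrow>
     'k set \<Rightarrow> (complex \<Rightarrow> 'k \<Rightarrow> 'k) \<Rightarrow> bool" where
  "uniform_dilation J T S A \<longleftrightarrow>
     dilation J T S A \<and>
     (\<forall>zs h. zs \<noteq> [] \<and> set zs \<subseteq> unit_circle \<longrightarrow>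
        J (foldr T zs h) = proj (range J) (foldr A zs (J h)))"

definition isometric_dilation ::
  "('h::chilbert_space \<Rightarrow> 'k::chilbert_space) \<Rightarrow> (complex \<Rightarrow> 'h \<Rightarrow> 'h) \<Rightarrow>
     'k set \<Rightarrow> (complex \<Rightarrow> 'k \<Rightarrow> 'k) \<Rightarrow> bool" where
  "isometric_dilation J T S A \<longleftrightarrow> dilation J T S A \<and> isometric_pencil_on S A"

definition uniform_isometric_dilation ::
  "('h::chilbert_space \<Rightarrow> 'k::chilbert_space) \<Rightarrow> (complex \<Rightarrow> 'h \<Rightarrow> 'h) \<Rightarrow>
     'k set \<Rightarrow> (complex \<Rightarrow> 'k \<Rightarrow> 'k) \<Rightarrow> bool" where
  "uniform_isometric_dilation J T S A \<longleftrightarrow> uniform_dilation J T S A \<and> isometric_pencil_on S A"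

definition compression ::
  "'k::chilbert_space set \<Rightarrow> (complex \<Rightarrow> 'k \<Rightarrow> 'k) \<Rightarrow> complex \<Rightarrow> 'k \<Rightarrow> 'k" where
  "compression S A \<zeta> x = proj S (A \<zeta> x)"

definition minimal_isometric_dilation ::
  "('h::chilbert_space \<Rightarrow> 'k::chilbert_space) \<Rightarrow> (complex \<Rightarrow> 'h \<Rightarrow> 'h) \<Rightarrow>
     'k set \<Rightarrow> (complex \<Rightarrow> 'k \<Rightarrow> 'k) \<Rightarrow> bool" where
  "minimal_isometric_dilation J T S A \<longleftrightarrow>
     isometric_dilation J T S A \<and>
     (\<forall>S'. closed_csubspace S' \<and> range J \<subseteq> S' \<and> S' \<subseteq> S \<and>
        isometric_dilation J T S' (compression S' A) \<longrightarrow> S' = S)"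

definition minimal_uniform_isometric_dilation ::
  "('h::chilbert_space \<Rightarrow> 'k::chilbert_space) \<Rightarrow> (complex \<Rightarrow> 'h \<Rightarrow> 'h) \<Rightarrow>
     'k set \<Rightarrow> (complex \<Rightarrow> 'k \<Rightarrow> 'k) \<Rightarrow> bool" where
  "minimal_uniform_isometric_dilation J T S A \<longleftrightarrow>
     uniform_isometric_dilation J T S A \<and>
     (\<forall>S'. closed_csubspace S' \<and> range J \<subseteq> S' \<and> S' \<subseteq> S \<and>
        uniform_isometric_dilation J T S' (compression S' A) \<longrightarrow> S' = S)"

section \<open>The dilation space\<close>

text \<open>
  The element \<open>(\<dots>, y\<^sub>-\<^sub>2, y\<^sub>-\<^sub>1, h)\<close> of the dilation space is the pair \<open>(y, h)\<close> in which the sequence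
  \<open>y\<close> is indexed by naturals: its entry at \<open>n\<close> is the component in the copy of \<open>'y\<close> with number
  \<open>- (n + 1)\<close>. Hence \<open>ell2_cons a y\<close> puts \<open>a\<close> into copy \<open>-1\<close> and moves copy \<open>-k\<close> of \<open>y\<close> to copy
  \<open>- k - 1\<close>.
\<close>

type_synonym ('y, 'h) dilation_space = "'y ell2 \<times> 'h"

lift_definition ell2_cons :: "'a::complex_inner \<Rightarrow> 'a ell2 \<Rightarrow> 'a ell2" is
  "\<lambda>a f n. case n of 0 \<Rightarrow> a | Suc m \<Rightarrow> f m"
  by (subst summable_Suc_iff[symmetric]) simp

definition dilation_pencil ::
  "(complex \<Rightarrow> 'h \<Rightarrow> 'y) \<Rightarrow> (complex \<Rightarrow> 'h \<Rightarrow> 'h) \<Rightarrow>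
     complex \<Rightarrow> ('y::chilbert_space, 'h::chilbert_space) dilation_space \<Rightarrow>
     ('y, 'h) dilation_space" where
  "dilation_pencil F T \<zeta> = (\<lambda>(y, h). (ell2_cons (F \<zeta> h) y, T \<zeta> h))"

definition dilation_embed ::
  "'h::chilbert_space \<Rightarrow> ('y::chilbert_space, 'h) dilation_space" where
  "dilation_embed h = (0, h)"

end

theory Submission
  imports Defs
begin

text \<open>
  Since \<open>V \<zeta>\<close> is isometric on the whole space, a compression of it to \<open>S'\<close> can only be isometric if
  \<open>S'\<close> is invariant under every \<open>V \<zeta>\<close>. Applying \<open>V 1\<close> and \<open>V (-1)\<close> to the copy of \<open>'h\<close> shows that
  \<open>S'\<close> contains the ranges of \<open>F0\<close> and \<open>F1\<close>, placed in copy \<open>-1\<close>. These ranges span a dense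
  subspace: a nonzero \<open>y\<close> orthogonal to both would be a constant function in the Hardy space at
  distance at least \<open>norm y\<close> from all functions \<open>F f\<close>, contrary to \<open>F\<close> being outer. Hence
  \<open>S'\<close> contains copy \<open>-1\<close> and, by invariance, all other copies.
\<close>

section \<open>Projection theorem and adjoints\<close>

lemma scaleC_minus_one: "(-1) *\<^sub>C x = - (x::'a::complex_inner)"
  using scaleC_of_real[of "-1" x] by simp

lemma cinner_zero_left: "cinner 0 (y::'a::complex_inner) = 0"
  using cinner_add_left[of 0 0 y] by simp

lemma cinner_minus_left: "cinner (- x) y = - cinner x (y::'a::complex_inner)"
  using cinner_scaleC_left[of "-1" x y] by (simp add: scaleC_minus_one)

lemma cinner_diff_left: "cinner (x - z) y = cinner x y - cinner z (y::'a::complex_inner)"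
  using cinner_add_left[of x "- z" y] by (simp add: cinner_minus_left)

lemma cinner_eq_0_commute: "cinner x y = 0 \<longleftrightarrow> cinner y (x::'a::complex_inner) = 0"
  by (metis cinner_commute complex_cnj_zero_iff)

lemma cinner_self_eq_0_iff: "cinner x x = 0 \<longleftrightarrow> (x::'a::complex_inner) = 0"
  by (simp add: cinner_self)

lemma bounded_linear_cinner_left: "bounded_linear (\<lambda>x. cinner x (y::'a::complex_inner))"
proof (rule bounded_linear_intro)
  show "cinner (x + z) y = cinner x y + cinner z y" for x z by (rule cinner_add_left)
  show "cinner (r *\<^sub>R x) y = r *\<^sub>R cinner x y" for r x
    by (simp only: scaleC_of_real[of r x, symmetric] cinner_scaleC_left scaleR_conv_of_real)
  show "norm (cinner x y) \<le> norm x * norm y" for x by (simp add: cmod_cinner_le)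
qed

text \<open>Gives access to the continuity and composition rules of \<open>bounded_linear\<close>;
  real homogeneity is complex homogeneity for a real scalar.\<close>

lemma bounded_op_iff:
  "bounded_op A \<longleftrightarrow> bounded_linear A \<and> (\<forall>a x. A (a *\<^sub>C x) = a *\<^sub>C A x)"
proof
  assume A: "bounded_op A"
  then obtain K where K: "\<And>x. norm (A x) \<le> K * norm x" by (auto simp: bounded_op_on_def)
  have "bounded_linear A"
  proof (rule bounded_linear_intro)
    show "A (x + y) = A x + A y" for x y using A by (simp add: bounded_op_on_def)
    show "A (r *\<^sub>R x) = r *\<^sub>R A x" for r x
      using A by (simp add: bounded_op_on_def scaleC_of_real[symmetric])
    show "norm (A x) \<le> norm x * K" for x using K[of x] by (simp add: mult.commute)
  qed
  then show "bounded_linear A \<and> (\<forall>a x. A (a *\<^sub>C x) = a *\<^sub>C A x)"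
    using A by (simp add: bounded_op_on_def)
next
  assume A: "bounded_linear A \<and> (\<forall>a x. A (a *\<^sub>C x) = a *\<^sub>C A x)"
  then obtain K where "\<forall>x. norm (A x) \<le> norm x * K" using bounded_linear.bounded by blast
  then have "\<exists>K. \<forall>x. norm (A x) \<le> K * norm x" by (metis mult.commute)
  then show "bounded_op A"
    using A by (simp add: bounded_op_on_def bounded_linear.linear linear_add)
qed

lemma closed_csubspace_diff:
  "closed_csubspace S \<Longrightarrow> x \<in> S \<Longrightarrow> y \<in> S \<Longrightarrow> x - y \<in> S"
  unfolding closed_csubspace_def using scaleC_minus_one[of y] by (metis diff_conv_add_uminus)

lemma closed_csubspace_scaleR: "closed_csubspace S \<Longrightarrow> x \<in> S \<Longrightarrow> r *\<^sub>R x \<in> S"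
  unfolding closed_csubspace_def by (metis scaleC_of_real)

lemma closed_csubspace_UNIV: "closed_csubspace UNIV"
  by (simp add: closed_csubspace_def)

text \<open>Used for kernels of functionals, for the copy of \<open>'h\<close> (the kernel of
  \<open>fst\<close>), and for the set of vectors whose copy at position -1 lies in a given
  subspace.\<close>

lemma closed_csubspace_vimage:
  assumes "bounded_op A" "closed_csubspace S"
  shows "closed_csubspace (A -` S)"
proof -
  have A: "bounded_linear A" "\<And>a x. A (a *\<^sub>C x) = a *\<^sub>C A x"
    using assms(1) by (auto simp: bounded_op_iff)
  have "closed (A -` S)"
    using assms(2) A(1) by (intro continuous_closed_vimage)
      (auto simp: closed_csubspace_def intro: linear_continuous_at)
  moreover have "A 0 = 0" using A(1) bounded_linear.linear linear_0 by blast
  ultimately show ?thesis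
    using assms(2) A bounded_linear.linear[OF A(1)]
    by (simp add: closed_csubspace_def linear_add)
qed

section \<open>Orthogonal projections onto closed subspaces\<close>

lemma minimizer_orthogonal:
  assumes S: "closed_csubspace S" and "y \<in> S" "z \<in> S"
    and min: "\<And>w. w \<in> S \<Longrightarrow> norm (x - y) \<le> norm (x - w)"
  shows "cinner (x - y) z = 0"
proof -
  have re: "inner (x - y) z = 0" if "z \<in> S" for z
  proof (cases "z = 0")
    case False
    let ?u = "x - y"
    \<comment> \<open>The minimizer of \<open>norm (?u - t *\<^sub>R z)\<close>; as
      \<open>t = 0\<close> is already optimal, \<open>inner ?u z\<close> must vanish.\<close>
    define t where "t = inner ?u z / inner z z"
    have nz: "inner z z > 0" using False by simp
    have "y + t *\<^sub>R z \<in> S"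
      using S \<open>y \<in> S\<close> that closed_csubspace_scaleR[OF S that] by (simp add: closed_csubspace_def)
    then have "(norm ?u)\<^sup>2 \<le> (norm (x - (y + t *\<^sub>R z)))\<^sup>2"
      using min by (simp add: power_mono)
    then have "inner ?u ?u \<le> inner (?u - t *\<^sub>R z) (?u - t *\<^sub>R z)"
      by (simp add: power2_norm_eq_inner algebra_simps)
    also have "\<dots> = inner ?u ?u - 2 * t * inner ?u z + t * t * inner z z"
      by (simp add: inner_diff_left inner_diff_right inner_commute algebra_simps)
    finally have "2 * t * inner ?u z \<le> t * t * inner z z" by simp
    moreover have "t * inner z z = inner ?u z" using nz by (simp add: t_def)
    ultimately have "t * inner ?u z \<le> 0" by (simp add: mult.assoc)
    then have "inner ?u z * inner ?u z \<le> 0" using nz by (simp add: t_def divide_le_0_iff)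
    then show ?thesis by (metis mult_eq_0_iff order_antisym zero_le_square)
  qed simp
  \<comment> \<open>The real inner product sees only real parts; testing against
    \<open>\<i> *\<^sub>C z\<close> recovers the imaginary part.\<close>
  have "\<i> *\<^sub>C z \<in> S" using S \<open>z \<in> S\<close> by (simp add: closed_csubspace_def)
  then have "Re (cinner (x - y) (\<i> *\<^sub>C z)) = 0" using re by (simp add: inner_eq_Re_cinner)
  moreover have "Re (cinner (x - y) z) = 0" using re[OF \<open>z \<in> S\<close>] by (simp add: inner_eq_Re_cinner)
  ultimately show ?thesis by (simp add: cinner_scaleC_right complex_eq_iff)
qed

text \<open>A minimizing sequence for the distance to \<open>x\<close> is Cauchy by the
  parallelogram law, and its limit is a minimizer in \<open>S\<close>.\<close>

lemma orthogonal_projection_exists: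
  fixes S :: "'a::chilbert_space set"
  assumes S: "closed_csubspace S"
  shows "\<exists>y\<in>S. \<forall>z\<in>S. cinner (x - y) z = 0"
proof -
  define D where "D = (INF w\<in>S. (norm (x - w))\<^sup>2)"
  have ne: "S \<noteq> {}" using S by (auto simp: closed_csubspace_def)
  have bdd: "bdd_below ((\<lambda>w. (norm (x - w))\<^sup>2) ` S)" by (rule bdd_belowI[of _ 0]) auto
  have D: "D \<le> (norm (x - w))\<^sup>2" if "w \<in> S" for w
    unfolding D_def using bdd that by (rule cINF_lower)
  have "\<exists>w\<in>S. (norm (x - w))\<^sup>2 < D + 1 / real (Suc n)" for n
    using cINF_less_iff[OF ne bdd, of "D + 1 / real (Suc n)"] by (simp add: D_def)
  then obtain f where f: "\<And>n. f n \<in> S" "\<And>n. (norm (x - f n))\<^sup>2 < D + 1 / real (Suc n)"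
    by metis
  have close: "(norm (f m - f n))\<^sup>2 < 2 / real (Suc m) + 2 / real (Suc n)" for m n
  proof -
    \<comment> \<open>The midpoint stays in \<open>S\<close>, so its squared distance to
      \<open>x\<close> is at least \<open>D\<close>; the parallelogram law then leaves only the two
      error terms.\<close>
    let ?c = "(1/2) *\<^sub>R (f m + f n)"
    have "f m + f n \<in> S" using f(1) S by (simp add: closed_csubspace_def)
    then have c: "D \<le> (norm (x - ?c))\<^sup>2" by (intro D closed_csubspace_scaleR S)
    have "(norm (f m - f n))\<^sup>2 + 4 * (norm (x - ?c))\<^sup>2
        = 2 * (norm (x - f m))\<^sup>2 + 2 * (norm (x - f n))\<^sup>2"
      by (simp add: power2_norm_eq_inner inner_diff_left inner_diff_right inner_add_left
          inner_add_right inner_commute algebra_simps)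
    then show ?thesis using c f(2)[of m] f(2)[of n] by simp
  qed
  have "Cauchy f"
  proof (rule metric_CauchyI)
    fix e :: real assume "0 < e"
    then obtain N where N: "inverse (real (Suc N)) < e\<^sup>2 / 4"
      using reals_Archimedean[of "e\<^sup>2 / 4"] by auto
    have "dist (f m) (f n) < e" if "m \<ge> N" "n \<ge> N" for m n
    proof -
      have "1 / real (Suc k) < e\<^sup>2 / 4" if "k \<ge> N" for k
      proof -
        have "1 / real (Suc k) \<le> inverse (real (Suc N))"
          using that by (simp add: field_simps)
        then show ?thesis using N by linarith
      qed
      from this[OF that(1)] this[OF that(2)] have "(norm (f m - f n))\<^sup>2 < e\<^sup>2"
        using close[of m n] by simp
      then show ?thesis
        using \<open>0 < e\<close> by (simp add: dist_norm power_less_imp_less_base)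
    qed
    then show "\<exists>M. \<forall>m\<ge>M. \<forall>n\<ge>M. dist (f m) (f n) < e" by blast
  qed
  then obtain y where y: "f \<longlonglongrightarrow> y" using Cauchy_convergent convergent_def by blast
  have "y \<in> S" using S f(1) y closed_sequentially by (auto simp: closed_csubspace_def)
  have "(norm (x - y))\<^sup>2 \<le> D + 0"
  proof (rule LIMSEQ_le)
    show "(\<lambda>n. (norm (x - f n))\<^sup>2) \<longlonglongrightarrow> (norm (x - y))\<^sup>2" by (intro tendsto_intros y)
    show "(\<lambda>n. D + 1 / real (Suc n)) \<longlonglongrightarrow> D + 0"
      using LIMSEQ_inverse_real_of_nat by (intro tendsto_intros) (simp add: divide_inverse)
    show "\<exists>N. \<forall>n\<ge>N. (norm (x - f n))\<^sup>2 \<le> D + 1 / real (Suc n)"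
      using f(2) less_imp_le by blast
  qed
  then have "(norm (x - y))\<^sup>2 \<le> (norm (x - w))\<^sup>2" if "w \<in> S" for w
    using D[OF that] by linarith
  then have "norm (x - y) \<le> norm (x - w)" if "w \<in> S" for w
    using that power2_le_imp_le[OF _ norm_ge_zero] by blast
  then show ?thesis using minimizer_orthogonal[OF S \<open>y \<in> S\<close>] \<open>y \<in> S\<close> by blast
qed

text \<open>Justifies the definite description: two candidates differ by an element of
  \<open>S\<close> that is orthogonal to itself.\<close>

lemma proj_eqI:
  assumes S: "closed_csubspace S" and y: "y \<in> S" "\<And>z. z \<in> S \<Longrightarrow> cinner (x - y) z = 0"
  shows "proj S x = y"
  unfolding proj_def
proof (rule the_equality)
  fix u assume u: "u \<in> S \<and> (\<forall>z\<in>S. cinner (x - u) z = 0)"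
  then have uy: "u - y \<in> S" using S y(1) closed_csubspace_diff by blast
  have "cinner ((x - y) - (x - u)) (u - y) = 0"
    using u y(2)[OF uy] uy by (subst cinner_diff_left) simp
  then show "u = y" by (simp add: cinner_self_eq_0_iff)
qed (use y in auto)

lemma proj_mem: "closed_csubspace S \<Longrightarrow> proj S x \<in> S"
  and cinner_diff_proj: "closed_csubspace S \<Longrightarrow> z \<in> S \<Longrightarrow> cinner (x - proj S x) z = 0"
  using orthogonal_projection_exists[of S x] proj_eqI[of S _ x] by metis+

text \<open>The residual \<open>x - proj S x\<close> is orthogonal to \<open>S\<close>, hence zero.
  Serves as density criterion both in \<open>'y\<close> and in the dilation space.\<close>

lemma closed_csubspace_eq_UNIV:
  fixes S :: "'a::chilbert_space set"
  assumes S: "closed_csubspace S" and "\<And>x. (\<And>z. z \<in> S \<Longrightarrow> cinner z x = 0) \<Longrightarrow> x = 0"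
  shows "S = UNIV"
proof -
  have "x - proj S x = 0" for x
    using assms(2) cinner_diff_proj[OF S] cinner_eq_0_commute by metis
  then show ?thesis using proj_mem[OF S] by (metis UNIV_eq_I right_minus_eq)
qed

text \<open>By Pythagoras, a projection that loses no length fixes the vector. This is how an
  isometric compression yields an invariant subspace.\<close>

lemma norm_proj_eq_imp_mem:
  assumes S: "closed_csubspace S" and n: "norm (proj S x) = norm x"
  shows "x \<in> S"
proof -
  let ?p = "proj S x"
  have "inner (x - ?p) ?p = 0"
    using cinner_diff_proj[OF S proj_mem[OF S]] by (simp add: inner_eq_Re_cinner)
  then have "(norm x)\<^sup>2 = (norm ?p)\<^sup>2 + (norm (x - ?p))\<^sup>2"
    by (simp add: power2_norm_eq_inner inner_diff_left inner_diff_right inner_commute)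
  then have "x - ?p = 0" using n by simp
  then show ?thesis using proj_mem[OF S, of x] by simp
qed

section \<open>Riesz representation and adjoints\<close>

lemma riesz_representation:
  fixes \<phi> :: "'a::chilbert_space \<Rightarrow> complex"
  assumes \<phi>: "bounded_op \<phi>"
  shows "\<exists>b. \<forall>x. \<phi> x = cinner x b"
proof (cases "\<forall>x. \<phi> x = 0")
  case True
  then show ?thesis by (metis cinner_eq_0_commute cinner_zero_left)
next
  case False
  then obtain x0 where x0: "\<phi> x0 \<noteq> 0" by blast
  have lin: "\<phi> (x - y) = \<phi> x - \<phi> y" "\<phi> (a *\<^sub>C x) = a * \<phi> x" for a x y
    using \<phi> by (auto simp: bounded_op_iff scaleC_complex_def bounded_linear.linear linear_diff)
  let ?N = "\<phi> -` {0}"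
  have N: "closed_csubspace ?N"
    by (rule closed_csubspace_vimage[OF \<phi>]) (simp add: closed_csubspace_def scaleC_complex_def)
  define w where "w = x0 - proj ?N x0"
  have w: "cinner w z = 0" if "\<phi> z = 0" for z
    using cinner_diff_proj[OF N] that by (simp add: w_def)
  have "\<phi> w = \<phi> x0" using proj_mem[OF N, of x0] by (simp add: w_def lin)
  then have pw: "\<phi> w \<noteq> 0" using x0 by simp
  then have "w \<noteq> 0" using lin(2)[of 0 w] lin(1)[of w w] by auto
  then have ww: "cinner w w \<noteq> 0" by (simp add: cinner_self_eq_0_iff)
  \<comment> \<open>Normalized so that \<open>cinner w b = \<phi> w\<close>; the conjugate
    compensates for conjugate linearity in the second argument.\<close>
  define b where "b = cnj (\<phi> w / cinner w w) *\<^sub>C w"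
  have "\<phi> x = cinner x b" for x
  proof -
    \<comment> \<open>This vector lies in the kernel of \<open>\<phi>\<close>, so it is orthogonal
      to \<open>w\<close>.\<close>
    let ?z = "x - (\<phi> x / \<phi> w) *\<^sub>C w"
    have "cinner ?z w = 0"
      using w[of ?z] pw by (subst cinner_eq_0_commute) (simp add: lin)
    then have "cinner x w = \<phi> x / \<phi> w * cinner w w"
      by (simp add: cinner_diff_left cinner_scaleC_left)
    then show ?thesis using pw ww by (simp add: b_def cinner_scaleC_right)
  qed
  then show ?thesis by blast
qed

text \<open>Riesz, applied for each \<open>y\<close>, gives an adjoint; it is determined by its
  inner products, so the definite description denotes it.\<close>

lemma cinner_cadjoint:
  fixes A :: "'a::chilbert_space \<Rightarrow> 'b::chilbert_space"
  assumes A: "bounded_op A"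
  shows "cinner (A x) y = cinner x (cadjoint A y)"
proof -
  have "bounded_op (\<lambda>x. cinner (A x) y)" for y
    using A bounded_linear_compose[OF bounded_linear_cinner_left]
    by (auto simp: bounded_op_iff cinner_scaleC_left scaleC_complex_def)
  then have "\<exists>b. \<forall>x. cinner (A x) y = cinner x b" for y by (rule riesz_representation)
  then obtain B where B: "\<And>x y. cinner (A x) y = cinner x (B y)" by metis
  have "cadjoint A = B"
    unfolding cadjoint_def
  proof (rule the_equality)
    fix C assume C: "\<forall>x y. cinner (A x) y = cinner x (C y)"
    show "C = B"
    proof
      fix y
      have "cinner (C y) x = cinner (B y) x" for x using B C by (metis cinner_commute)
      then have "cinner (C y - B y) (C y - B y) = 0" by (simp add: cinner_diff_left)
      then show "C y = B y" by (simp add: cinner_self_eq_0_iff)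
    qed
  qed (simp add: B)
  then show ?thesis by (simp add: B)
qed

section \<open>Pencils and outer functions\<close>

lemma bounded_linear_scaleC_right: "bounded_linear (\<lambda>x::'a::complex_inner. a *\<^sub>C x)"
proof (rule bounded_linear_intro)
  show "a *\<^sub>C (r *\<^sub>R x) = r *\<^sub>R (a *\<^sub>C x)" for r and x :: 'a
    by (simp add: scaleC_of_real[symmetric] scaleC_scaleC mult.commute)
  show "norm (a *\<^sub>C x) \<le> norm x * cmod a" for x :: 'a by (simp add: norm_scaleC)
qed (rule scaleC_add_right)

lemma tendsto_scaleC:
  fixes g :: "'b \<Rightarrow> 'a::complex_inner"
  assumes f: "(f \<longlongrightarrow> a) G" and g: "(g \<longlongrightarrow> b) G"
  shows "((\<lambda>x. f x *\<^sub>C g x) \<longlongrightarrow> a *\<^sub>C b) G"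
proof -
  have "bounded_bilinear (\<lambda>(a::complex) (x::'a). a *\<^sub>C x)"
  proof
    show "(a + a') *\<^sub>C b = a *\<^sub>C b + a' *\<^sub>C b" for a a' and b :: 'a by (rule scaleC_add_left)
    show "a *\<^sub>C (b + b') = a *\<^sub>C b + a *\<^sub>C b'" for a and b b' :: 'a by (rule scaleC_add_right)
    show "(r *\<^sub>R a) *\<^sub>C b = r *\<^sub>R a *\<^sub>C b" for r a and b :: 'a
      by (simp only: scaleC_of_real[of r "a *\<^sub>C b", symmetric] scaleC_scaleC scaleR_conv_of_real)
    show "a *\<^sub>C r *\<^sub>R b = r *\<^sub>R a *\<^sub>C b" for r a and b :: 'a
      by (simp add: scaleC_of_real[symmetric] scaleC_scaleC mult.commute)
    show "\<exists>K. \<forall>a (b::'a). norm (a *\<^sub>C b) \<le> norm a * norm b * K"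
      by (intro exI[of _ 1]) (simp add: norm_scaleC)
  qed
  from bounded_bilinear.tendsto[OF this f g] show ?thesis .
qed

lemma bounded_op_pencil:
  assumes "bounded_op A0" "bounded_op A1"
  shows "bounded_op (pencil A0 A1 \<zeta>)"
proof -
  have "bounded_linear (\<lambda>x. A0 x + \<zeta> *\<^sub>C A1 x)"
    using assms by (auto simp: bounded_op_iff
        intro!: bounded_linear_add bounded_linear_compose[OF bounded_linear_scaleC_right])
  moreover have "pencil A0 A1 \<zeta> = (\<lambda>x. A0 x + \<zeta> *\<^sub>C A1 x)" by (simp add: fun_eq_iff pencil_def)
  ultimately show ?thesis
    using assms by (simp add: bounded_op_iff scaleC_scaleC scaleC_add_right mult.commute)
qed

text \<open>Joint continuity is needed because in \<open>pencil F0 F1 z (f z)\<close> both the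
  parameter and the vector move with \<open>z\<close>.\<close>

lemma tendsto_pencil:
  assumes "bounded_op A0" "bounded_op A1" and f: "(f \<longlongrightarrow> a) G" and g: "(g \<longlongrightarrow> b) G"
  shows "((\<lambda>x. pencil A0 A1 (f x) (g x)) \<longlongrightarrow> pencil A0 A1 a b) G"
  unfolding pencil_def using assms
  by (auto simp: bounded_op_iff
      intro!: tendsto_add tendsto_scaleC bounded_linear.tendsto[where g = g])

section \<open>Circle integrals of holomorphic functions\<close>

lemma holomorphic_vec_isCont:
  assumes "holomorphic_vec f" "z \<in> unit_disk"
  shows "isCont f z"
proof -
  obtain d where "((\<lambda>w. inverse (w - z) *\<^sub>C (f w - f z)) \<longlongrightarrow> d) (at z)"
    using assms by (auto simp: holomorphic_vec_def)
  then have "((\<lambda>w. (w - z) *\<^sub>C (inverse (w - z) *\<^sub>C (f w - f z))) \<longlongrightarrow> (z - z) *\<^sub>C d) (at z)"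
    by (intro tendsto_scaleC tendsto_intros)
  moreover have "\<forall>\<^sub>F w in at z. (w - z) *\<^sub>C (inverse (w - z) *\<^sub>C (f w - f z)) = f w - f z"
    using scaleC_of_real[of 1] by (auto simp: eventually_at_filter scaleC_scaleC
        intro!: always_eventually)
  moreover have "(z - z) *\<^sub>C d = 0" using scaleC_of_real[of 0 d] by simp
  ultimately have "((\<lambda>w. f w - f z) \<longlongrightarrow> 0) (at z)"
    using Lim_transform_eventually by fastforce
  then show ?thesis by (simp add: isCont_def LIM_zero_iff)
qed

text \<open>\<open>integral\<close> defaults to 0 on non-integrable functions, so comparing circle
  integrals requires integrability; continuity inside the disk supplies it.\<close>

lemma circle_integrand_integrable:
  assumes r: "r \<in> {0<..<1}" and q: "\<And>z. z \<in> unit_disk \<Longrightarrow> isCont q z"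
  shows "(\<lambda>s. (norm (q (complex_of_real r * cis s)))\<^sup>2) integrable_on {0..2 * pi}"
proof (rule integrable_continuous_real)
  have "isCont (\<lambda>s. q (complex_of_real r * cis s)) s" for s
  proof (rule isCont_o2[where f = "\<lambda>s. complex_of_real r * cis s"])
    show "isCont (\<lambda>s. complex_of_real r * cis s) s"
      unfolding cis_conv_exp by (intro continuous_intros)
    show "isCont q (complex_of_real r * cis s)"
      using r by (intro q) (simp add: unit_disk_def norm_mult)
  qed
  then show "continuous_on {0..2 * pi} (\<lambda>s. (norm (q (complex_of_real r * cis s)))\<^sup>2)"
    by (intro continuous_intros continuous_at_imp_continuous_on) auto
qed

text \<open>The Hardy norm is a supremum over circles, so a lower bound on one circle suffices once
  the circle integrals are known to be bounded.\<close>

lemma outer_pencil_dense: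
  fixes F0 F1 :: "'h::chilbert_space \<Rightarrow> 'y::chilbert_space"
  assumes F: "bounded_op F0" "bounded_op F1" and out: "outer (pencil F0 F1)"
    and M: "closed_csubspace M" "range F0 \<subseteq> M" "range F1 \<subseteq> M"
  shows "M = UNIV"
proof (rule closed_csubspace_eq_UNIV[OF M(1)], rule ccontr)
  fix y assume y: "\<And>z. z \<in> M \<Longrightarrow> cinner z y = 0" and "y \<noteq> 0"
  let ?F = "pencil F0 F1"
  have FM: "?F z h \<in> M" for z h using M by (simp add: pencil_def closed_csubspace_def range_subsetD)
  have "bdd_above (circle_integral (\<lambda>_. y) ` {0<..<1})"
    by (rule bdd_aboveI[of _ "2 * pi * (norm y)\<^sup>2"]) (auto simp: circle_integral_def)
  moreover have "holomorphic_vec (\<lambda>_. y)"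
    unfolding holomorphic_vec_def by (auto simp: scaleC_zero_right)
  ultimately have "(\<lambda>_. y) \<in> hardy2" by (simp add: hardy2_def)
  then obtain f where f: "f \<in> hardy2" and lt: "hardy2_norm (\<lambda>z. y - ?F z (f z)) < norm y"
    using out \<open>y \<noteq> 0\<close> unfolding outer_def by (meson zero_less_norm_iff)
  let ?g = "\<lambda>z. y - ?F z (f z)"
  have contf: "isCont f z" if "z \<in> unit_disk" for z
    using f that by (simp add: hardy2_def holomorphic_vec_isCont)
  have contg: "isCont ?g z" if "z \<in> unit_disk" for z
    using contf[OF that] F unfolding isCont_def by (intro tendsto_intros tendsto_pencil)
  have intf: "(\<lambda>s. (norm (f (complex_of_real r * cis s)))\<^sup>2) integrable_on {0..2 * pi}"
    and intg: "(\<lambda>s. (norm (?g (complex_of_real r * cis s)))\<^sup>2) integrable_on {0..2 * pi}"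
    if "r \<in> {0<..<1}" for r
    using that circle_integrand_integrable contf contg by blast+
  obtain B where B: "\<And>r. r \<in> {0<..<1} \<Longrightarrow> circle_integral f r \<le> B"
    using f unfolding hardy2_def bdd_above_def by blast
  \<comment> \<open>Contractivity in the disk and (a + b)^2 \<le> 2 a^2 + 2 b^2 give a bound
    independent of \<open>r\<close>, so that the supremum dominates each circle.\<close>
  have "circle_integral ?g r \<le> 2 * (2 * pi * (norm y)\<^sup>2) + 2 * B" if r: "r \<in> {0<..<1}" for r
  proof -
    let ?c = "\<lambda>s. complex_of_real r * cis s"
    have "circle_integral ?g r
        \<le> integral {0..2 * pi} (\<lambda>s. 2 * (norm y)\<^sup>2 + 2 * (norm (f (?c s)))\<^sup>2)"
      unfolding circle_integral_def
    proof (rule integral_le)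
      fix s
      have "norm (?F (?c s) (f (?c s))) \<le> norm (f (?c s))"
        using out r by (simp add: outer_def unit_disk_def norm_mult)
      then have "norm (?g (?c s)) \<le> norm y + norm (f (?c s))"
        using norm_triangle_ineq4[of y "?F (?c s) (f (?c s))"] by linarith
      then have "(norm (?g (?c s)))\<^sup>2 \<le> (norm y + norm (f (?c s)))\<^sup>2" by (simp add: power_mono)
      also have "\<dots> \<le> 2 * (norm y)\<^sup>2 + 2 * (norm (f (?c s)))\<^sup>2"
        using sum_squares_bound[of "norm y" "norm (f (?c s))"] by (simp add: power2_sum)
      finally show "(norm (?g (?c s)))\<^sup>2 \<le> 2 * (norm y)\<^sup>2 + 2 * (norm (f (?c s)))\<^sup>2" .
    next
      show "(\<lambda>s. 2 * (norm y)\<^sup>2 + 2 * (norm (f (?c s)))\<^sup>2) integrable_on {0..2 * pi}"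
        by (intro integrable_add integrable_const_ivl integrable_on_mult_right intf[OF r])
    qed (rule intg[OF r])
    also have "\<dots> = 2 * (2 * pi * (norm y)\<^sup>2) + 2 * circle_integral f r"
    proof -
      have "integral {0..2 * pi} (\<lambda>s. 2 * (norm y)\<^sup>2 + 2 * (norm (f (?c s)))\<^sup>2)
          = integral {0..2 * pi} (\<lambda>s. 2 * (norm y)\<^sup>2)
            + integral {0..2 * pi} (\<lambda>s. 2 * (norm (f (?c s)))\<^sup>2)"
        by (intro integral_add integrable_const_ivl integrable_on_mult_right intf[OF r])
      then show ?thesis by (simp add: circle_integral_def)
    qed
    finally show ?thesis using B[OF r] by linarith
  qed
  then have bdd: "bdd_above (circle_integral ?g ` {0<..<1})"
    by (intro bdd_aboveI2)
  have half: "(1/2::real) \<in> {0<..<1}" by simp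
  have "2 * pi * (norm y)\<^sup>2 = integral {0..2 * pi} (\<lambda>s. (norm y)\<^sup>2)" by simp
  also have "\<dots> \<le> circle_integral ?g (1/2)"
    unfolding circle_integral_def
  proof (rule integral_le[OF integrable_const_ivl intg[OF half]])
    fix s
    \<comment> \<open>Values of \<open>?F\<close> are orthogonal to \<open>y\<close>, so subtracting
      one cannot shorten \<open>y\<close>.\<close>
    have "inner (?F z h) y = 0" for z h using y[OF FM] by (simp add: inner_eq_Re_cinner)
    then have "(norm (y - ?F z h))\<^sup>2 = (norm y)\<^sup>2 + (norm (?F z h))\<^sup>2" for z h
      by (simp add: power2_norm_eq_inner inner_diff_left inner_diff_right inner_commute)
    then show "(norm y)\<^sup>2 \<le> (norm (?g (complex_of_real (1/2) * cis s)))\<^sup>2" by simp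
  qed
  also have "\<dots> \<le> (SUP r\<in>{0<..<1}. circle_integral ?g r)" by (rule cSUP_upper[OF half bdd])
  finally have "(norm y)\<^sup>2 \<le> 1 / (2 * pi) * (SUP r\<in>{0<..<1}. circle_integral ?g r)"
    by (simp add: field_simps)
  then have "norm y \<le> hardy2_norm ?g" unfolding hardy2_norm_def by (rule real_le_rsqrt)
  then show False using lt by simp
qed

section \<open>The dilation space\<close>

text \<open>The entry at index 0 splits off the series. With the factorization this makes
  \<open>dilation_pencil\<close> isometric.\<close>

lemma norm_ell2_cons: "(norm (ell2_cons a y))\<^sup>2 = (norm a)\<^sup>2 + (norm y)\<^sup>2"
proof -
  have "(\<lambda>n. (norm (Rep_ell2 (ell2_cons a y) (Suc n)))\<^sup>2) sums (norm y)\<^sup>2"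
    using norm_ell2_sums[of y] by (simp add: ell2_cons.rep_eq)
  then have "(\<lambda>n. (norm (Rep_ell2 (ell2_cons a y) n))\<^sup>2) sums ((norm y)\<^sup>2 + (norm a)\<^sup>2)"
    by (subst (asm) sums_Suc_iff) (simp add: ell2_cons.rep_eq)
  then show ?thesis using norm_ell2_sums[of "ell2_cons a y"] sums_unique2 by fastforce
qed

lemma ell2_cons_add: "ell2_cons (a + b) (x + y) = ell2_cons a x + ell2_cons b y"
  by transfer (auto split: nat.split)

lemma ell2_cons_scaleC: "ell2_cons (c *\<^sub>C a) (c *\<^sub>C x) = c *\<^sub>C ell2_cons a x"
  by transfer (auto split: nat.split)

text \<open>Stated on pairs so that the composition and pairing rules for bounded operators cover
  prepending.\<close>

lemma bounded_op_ell2_cons: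
  "bounded_op (\<lambda>p::'a::complex_inner \<times> 'a ell2. ell2_cons (fst p) (snd p))"
  unfolding bounded_op_on_def
proof (intro conjI ballI allI exI)
  fix p :: "'a \<times> 'a ell2"
  show "norm (ell2_cons (fst p) (snd p)) \<le> 1 * norm p"
    by (simp add: norm_prod_def real_le_rsqrt norm_ell2_cons)
qed (auto simp: ell2_cons_add scaleC_prod_def ell2_cons_scaleC)

lemma bounded_op_compose:
  "bounded_op A \<Longrightarrow> bounded_op B \<Longrightarrow> bounded_op (\<lambda>x. A (B x))"
  by (simp add: bounded_op_iff bounded_linear_compose)

lemma bounded_op_Pair:
  "bounded_op A \<Longrightarrow> bounded_op B \<Longrightarrow> bounded_op (\<lambda>x. (A x, B x))"
  by (simp add: bounded_op_iff bounded_linear_Pair scaleC_prod_def)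

lemma bounded_op_fst: "bounded_op fst" and bounded_op_snd: "bounded_op snd"
  by (simp_all add: bounded_op_iff bounded_linear_fst bounded_linear_snd scaleC_prod_def)

lemma bounded_op_zero: "bounded_op (\<lambda>_. 0)" and bounded_op_ident: "bounded_op (\<lambda>x. x)"
  by (simp_all add: bounded_op_iff scaleC_zero_right)

lemmas bounded_op_cons = bounded_op_compose[OF bounded_op_ell2_cons bounded_op_Pair, simplified]

lemma linear_pencil_on_dilation_pencil:
  assumes "bounded_op F0" "bounded_op F1" "bounded_op T0" "bounded_op T1"
  shows "linear_pencil_on UNIV (dilation_pencil (pencil F0 F1) (pencil T0 T1))"
  unfolding linear_pencil_on_def
proof (intro conjI exI ballI closed_csubspace_UNIV)
  \<comment> \<open>The shift does not depend on \<open>\<zeta>\<close>, so it goes into the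
    constant coefficient, and the other one has tail 0.\<close>
  let ?V0 = "\<lambda>k. (ell2_cons (F0 (snd k)) (fst k), T0 (snd k))"
  let ?V1 = "\<lambda>k. (ell2_cons (F1 (snd k)) 0, T1 (snd k))"
  show "bounded_op ?V0" "bounded_op ?V1"
    by (intro bounded_op_Pair bounded_op_cons bounded_op_compose[OF _ bounded_op_snd]
        bounded_op_fst bounded_op_zero assms)+
  show "dilation_pencil (pencil F0 F1) (pencil T0 T1) \<zeta> k = pencil ?V0 ?V1 \<zeta> k" for \<zeta> k
    using ell2_cons_add[of "F0 (snd k)" "\<zeta> *\<^sub>C F1 (snd k)" "fst k" 0]
      ell2_cons_scaleC[of \<zeta> "F1 (snd k)" 0]
    by (cases k) (simp add: dilation_pencil_def pencil_def scaleC_prod_def scaleC_zero_right)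
qed

section \<open>The embedded space and the dilation identities\<close>

lemma isometric_embedding_dilation_embed:
  "isometric_embedding (dilation_embed :: 'h::chilbert_space \<Rightarrow> ('y::chilbert_space, 'h) dilation_space)"
  unfolding isometric_embedding_def dilation_embed_def
  by (intro conjI allI bounded_op_Pair bounded_op_zero bounded_op_ident) (simp add: norm_Pair)

text \<open>The range is the kernel of \<open>fst\<close>, hence closed. Dilation identities thereby
  reduce to second components.\<close>

lemma proj_range_dilation_embed:
  fixes k :: "('y::chilbert_space, 'h::chilbert_space) dilation_space"
  shows "proj (range dilation_embed) k = dilation_embed (snd k)"
proof (rule proj_eqI)
  have "range dilation_embed = (fst -` {0} :: ('y, 'h) dilation_space set)"
    by (auto simp: dilation_embed_def)
  then show "closed_csubspace (range dilation_embed :: ('y, 'h) dilation_space set)"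
    using closed_csubspace_vimage[OF bounded_op_fst, of "{0}"]
    by (simp add: closed_csubspace_def[of "{0}"] scaleC_zero_right)
qed (auto simp: dilation_embed_def cinner_prod_def cinner_zero_left
    cinner_eq_0_commute[of _ 0])

text \<open>The \<open>'h\<close>-component evolves by \<open>T\<close> alone, whatever the
  sequence; hence products of the dilating operators project to products of values of
  \<open>T\<close>.\<close>

lemma snd_dilation_pencil: "snd (dilation_pencil F T \<zeta> k) = T \<zeta> (snd k)"
  by (simp add: dilation_pencil_def split_beta)

lemma snd_foldr_dilation_pencil:
  "snd (foldr (dilation_pencil F T) zs k) = foldr T zs (snd k)"
  by (induction zs) (simp_all add: snd_dilation_pencil)

lemma snd_funpow_dilation_pencil:
  "snd ((dilation_pencil F T \<zeta> ^^ n) k) = (T \<zeta> ^^ n) (snd k)"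
  by (induction n) (simp_all add: snd_dilation_pencil)

lemma norm_dilation_pencil:
  assumes "(norm (F \<zeta> (snd k)))\<^sup>2 + (norm (T \<zeta> (snd k)))\<^sup>2 = (norm (snd k))\<^sup>2"
  shows "norm (dilation_pencil F T \<zeta> k) = norm k"
  using assms by (cases k) (simp add: dilation_pencil_def norm_Pair norm_ell2_cons algebra_simps)

text \<open>Pairing the operator identity with \<open>h\<close> turns it into an identity of
  norms.\<close>

lemma norm_pencil_factorization:
  assumes "bounded_op A" "bounded_op B"
    and eq: "cadjoint A (A h) = h - cadjoint B (B h)"
  shows "(norm (A h))\<^sup>2 + (norm (B h))\<^sup>2 = (norm h)\<^sup>2"
proof -
  have "cinner h (cadjoint A (A h) + cadjoint B (B h)) = cinner h h" by (simp add: eq)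
  then have "cinner (A h) (A h) + cinner (B h) (B h) = cinner h h"
    by (simp add: cinner_add_right cinner_cadjoint[OF assms(1)] cinner_cadjoint[OF assms(2)])
  then have "complex_of_real ((norm (A h))\<^sup>2 + (norm (B h))\<^sup>2) = complex_of_real ((norm h)\<^sup>2)"
    by (simp add: cinner_self)
  then show ?thesis using of_real_eq_iff by blast
qed

text \<open>The sequence supported at index \<open>n\<close>, written as an iterated shift because
  invariance under the dilating pencil reaches it that way.\<close>

definition ell2_single :: "nat \<Rightarrow> 'a::complex_inner \<Rightarrow> 'a ell2" where
  "ell2_single n a = (ell2_cons 0 ^^ n) (ell2_cons a 0)"

text \<open>The second summand pairs \<open>x\<close> with the backward shift of
  \<open>y\<close>.\<close>

lemma cinner_ell2_cons:
  "cinner (ell2_cons a x) y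
     = cinner a (Rep_ell2 y 0) + cinner x (Abs_ell2 (\<lambda>n. Rep_ell2 y (Suc n)))"
proof -
  have y: "summable (\<lambda>n. (norm (Rep_ell2 y n))\<^sup>2)" using Rep_ell2[of y] by simp
  then have y': "summable (\<lambda>n. (norm (Rep_ell2 y (Suc n)))\<^sup>2)"
    by (subst summable_Suc_iff)
  have c: "summable (\<lambda>n. cinner (Rep_ell2 (ell2_cons a x) n) (Rep_ell2 y n))"
    using Rep_ell2[of "ell2_cons a x"] y by (simp add: ell2_summable_cinner)
  show ?thesis
    using suminf_split_head[OF c] y'
    by (simp add: cinner_ell2.rep_eq ell2_cons.rep_eq Abs_ell2_inverse)
qed

text \<open>Reads off coordinates. The induction generalizes \<open>y\<close> since each step
  replaces it by its backward shift.\<close>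

lemma cinner_ell2_single: "cinner (ell2_single n a) y = cinner a (Rep_ell2 y n)"
proof (induction n arbitrary: y)
  case 0
  then show ?case by (simp add: ell2_single_def cinner_ell2_cons cinner_zero_left)
next
  case (Suc n)
  have "summable (\<lambda>n. (norm (Rep_ell2 y n))\<^sup>2)" using Rep_ell2[of y] by simp
  then have "summable (\<lambda>n. (norm (Rep_ell2 y (Suc n)))\<^sup>2)" by (subst summable_Suc_iff)
  then have "Rep_ell2 (Abs_ell2 (\<lambda>n. Rep_ell2 y (Suc n))) n = Rep_ell2 y (Suc n)"
    by (simp add: Abs_ell2_inverse)
  then show ?case
    using Suc by (simp add: ell2_single_def cinner_ell2_cons cinner_zero_left)
qed

text \<open>Two points of the circle suffice: 1 and -1 separate \<open>F0\<close> from
  \<open>F1\<close>, and the pencil at 1 shifts sequences with zero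
  \<open>'h\<close>-component.\<close>

lemma dilation_pencil_invariant_eq_UNIV:
  fixes F0 F1 :: "'h::chilbert_space \<Rightarrow> 'y::chilbert_space"
  assumes F: "bounded_op F0" "bounded_op F1" and T: "bounded_op T0" "bounded_op T1"
    and out: "outer (pencil F0 F1)"
    and S: "closed_csubspace S" "range dilation_embed \<subseteq> S"
    and inv: "\<And>\<zeta> k. \<zeta> \<in> unit_circle \<Longrightarrow> k \<in> S \<Longrightarrow>
      dilation_pencil (pencil F0 F1) (pencil T0 T1) \<zeta> k \<in> S"
  shows "S = UNIV"
proof -
  let ?F = "pencil F0 F1" and ?T = "pencil T0 T1"
  let ?J = "\<lambda>y::'y. (ell2_cons y 0, 0 :: 'h)"
  have J: "bounded_op ?J"
    by (intro bounded_op_Pair bounded_op_cons bounded_op_zero bounded_op_ident)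
  define M where "M = ?J -` S"
  have M: "closed_csubspace M" unfolding M_def by (rule closed_csubspace_vimage[OF J S(1)])
  have embed: "(0, h) \<in> S" for h using S(2) by (auto simp: dilation_embed_def)
  \<comment> \<open>The image of \<open>(0, h)\<close> has \<open>?F \<zeta> h\<close> in copy -1
    and \<open>?T \<zeta> h\<close> in \<open>'h\<close>; the latter part lies in the embedded copy
    and can be subtracted.\<close>
  have FM: "?F \<zeta> h \<in> M" if "\<zeta> \<in> unit_circle" for \<zeta> h
    using closed_csubspace_diff[OF S(1) inv[OF that embed] embed, of h "?T \<zeta> h"]
    by (simp add: dilation_pencil_def M_def)
  have one: "1 \<in> unit_circle" "-1 \<in> unit_circle" by (simp_all add: unit_circle_def)
  have F1: "?F 1 h = F0 h + F1 h" "?F (-1) h = F0 h - F1 h" for h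
    using scaleC_of_real[of 1 "F1 h"] by (simp_all add: pencil_def scaleC_minus_one)
  have F0M: "F0 h \<in> M" for h
  proof -
    have "?F 1 h + ?F (-1) h \<in> M" using FM[OF one(1)] FM[OF one(2)] M
      by (simp add: closed_csubspace_def)
    then have "(1/2) *\<^sub>R (?F 1 h + ?F (-1) h) \<in> M" by (rule closed_csubspace_scaleR[OF M])
    then show ?thesis by (simp add: F1 scaleR_2[symmetric])
  qed
  have "F1 h \<in> M" for h using closed_csubspace_diff[OF M FM[OF one(1)] F0M, of h h] by (simp add: F1)
  then have "M = UNIV" using outer_pencil_dense[OF F out M] F0M by blast
  then have M': "?J y \<in> S" for y by (auto simp: M_def)
  \<comment> \<open>Ensures that on \<open>(y, 0)\<close> the pencil at 1 only prepends 0, which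
    drives the induction over the copies.\<close>
  have zero: "?F 1 0 = 0" "?T 1 0 = 0"
    using bounded_op_pencil[OF F] bounded_op_pencil[OF T]
    by (auto simp: bounded_op_iff bounded_linear.linear linear_0)
  have single: "(ell2_single n y, 0) \<in> S" for n y
  proof (induction n)
    case 0
    then show ?case using M' by (simp add: ell2_single_def)
  next
    case (Suc n)
    then show ?case using inv[OF one(1) Suc] by (simp add: dilation_pencil_def ell2_single_def zero)
  qed
  show ?thesis
  proof (rule closed_csubspace_eq_UNIV[OF S(1)])
    fix k :: "('y, 'h) dilation_space" assume k: "\<And>z. z \<in> S \<Longrightarrow> cinner z k = 0"
    \<comment> \<open>Testing against the entry itself, placed at index \<open>n\<close>, gives its
      squared norm.\<close>
    have "Rep_ell2 (fst k) n = 0" for n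
      using k[OF single[of n "Rep_ell2 (fst k) n"]]
      by (simp add: cinner_prod_def cinner_zero_left cinner_ell2_single cinner_self_eq_0_iff)
    then have "Rep_ell2 (fst k) = Rep_ell2 0" by (simp add: fun_eq_iff zero_ell2.rep_eq)
    then have "fst k = 0" using Rep_ell2_inject by blast
    moreover have "snd k = 0"
      using k[OF embed[of "snd k"]]
      by (simp add: cinner_prod_def cinner_zero_left cinner_self_eq_0_iff)
    ultimately show "k = 0" by (simp add: prod_eq_iff)
  qed
qed

theorem theorem2p2:
  fixes T0 T1 :: "'h::chilbert_space \<Rightarrow> 'h"
    and F0 F1 :: "'h \<Rightarrow> 'y::chilbert_space"
    and T :: "complex \<Rightarrow> 'h \<Rightarrow> 'h"
    and F :: "complex \<Rightarrow> 'h \<Rightarrow> 'y"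
    and V :: "complex \<Rightarrow> ('y, 'h) dilation_space \<Rightarrow> ('y, 'h) dilation_space"
  assumes "separable_space (euclidean :: 'h topology)"
    and "separable_space (euclidean :: 'y topology)"
    and "bounded_op T0" and "bounded_op T1" and "T = pencil T0 T1"
    and "contractive_pencil_on UNIV T"
    and "bounded_op F0" and "bounded_op F1" and "F = pencil F0 F1"
    and "outer F"
    and "\<And>\<zeta> h. \<zeta> \<in> unit_circle \<Longrightarrow>
           cadjoint (F \<zeta>) (F \<zeta> h) = h - cadjoint (T \<zeta>) (T \<zeta> h)"
    and "V = dilation_pencil F T"
  shows "minimal_isometric_dilation dilation_embed T UNIV V \<and>
         minimal_uniform_isometric_dilation dilation_embed T UNIV V"
proof -
  note F = \<open>bounded_op F0\<close> \<open>bounded_op F1\<close> and T = \<open>bounded_op T0\<close> \<open>bounded_op T1\<close>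
  note defs = \<open>T = pencil T0 T1\<close> \<open>F = pencil F0 F1\<close> \<open>V = dilation_pencil F T\<close>
  have lin: "linear_pencil_on UNIV V"
    unfolding defs by (rule linear_pencil_on_dilation_pencil[OF F T])
  have norm: "norm (V \<zeta> k) = norm k" if "\<zeta> \<in> unit_circle" for \<zeta> k
    unfolding \<open>V = dilation_pencil F T\<close>
    by (intro norm_dilation_pencil norm_pencil_factorization assms(11) that)
      (simp_all add: defs(1,2) bounded_op_pencil F T)
  have iso: "isometric_pencil_on UNIV V" using lin norm by (simp add: isometric_pencil_on_def)
  have "linear_pencil_on UNIV T"
    using \<open>contractive_pencil_on UNIV T\<close> by (simp add: contractive_pencil_on_def)
  then have dil: "uniform_dilation dilation_embed T UNIV V"
    using lin isometric_embedding_dilation_embed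
    by (simp add: uniform_dilation_def dilation_def proj_range_dilation_embed
        \<open>V = dilation_pencil F T\<close> snd_foldr_dilation_pencil snd_funpow_dilation_pencil)
      (simp add: dilation_embed_def)
  \<comment> \<open>Both minimality claims reduce to this, since each requires the compression to be
    an isometric pencil on \<open>S'\<close>.\<close>
  have "S' = UNIV"
    if S: "closed_csubspace S'" "range dilation_embed \<subseteq> S'"
      and isoS: "isometric_pencil_on S' (compression S' V)" for S'
  proof (rule dilation_pencil_invariant_eq_UNIV[OF F T _ S])
    show "outer (pencil F0 F1)" using \<open>outer F\<close> by (simp add: defs)
    fix \<zeta> k assume "\<zeta> \<in> unit_circle" "k \<in> S'"
    \<comment> \<open>Both sides equal \<open>norm k\<close>, by isometry of the compression and of
      \<open>V\<close>.\<close>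
    then have "norm (proj S' (V \<zeta> k)) = norm (V \<zeta> k)"
      using isoS by (simp add: isometric_pencil_on_def compression_def norm)
    then show "dilation_pencil (pencil F0 F1) (pencil T0 T1) \<zeta> k \<in> S'"
      using norm_proj_eq_imp_mem[OF S(1)] by (simp add: defs)
  qed
  then show ?thesis
    using dil iso
    by (simp add: minimal_isometric_dilation_def minimal_uniform_isometric_dilation_def
        isometric_dilation_def uniform_isometric_dilation_def uniform_dilation_def)
qed

end
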